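(* There exist an infinite set $\mathcal{N}\subseteq\mathbb{N}$ and a function $\varepsilon:\mathbb{N}\to[0,\infty)$ with $\varepsilon(n)\to 0$ as $n\to\infty$ such that for every $n\in\mathcal{N}$ there exists a connected vertex transitive digraph on $n$ vertices whose perimeter gap is at least $(1-\varepsilon(n))\ln n$.
   Context: All digraphs are finite, without loops or multiple arcs (pairs of opposite arcs are allowed). A digraph is vertex transitive if its automorphism group acts transitively on its vertices; it is connected if its underlying undirected graph is connected. A directed cycle has length at least $2$. The perimeter gap of a digraph $D$ is $|V(D)|$ minus the length of a longest directed cycle in $D$. *)

theory Defs
  imports Complex_Main "Graph_Theory.Graph_Theory"
begin

text \<open>
  An isomorphism in the library carries its own head and tail maps for the target digraph;
  it is an automorphism when the target is the original digraph.
\<close>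

definition digraph_automorphism ::
    "('a, 'b) pre_digraph \<Rightarrow> ('a, 'b, 'a, 'b) digraph_isomorphism \<Rightarrow> bool" where
  "digraph_automorphism G f \<longleftrightarrow> pre_digraph.digraph_isomorphism G f \<and> app_iso f G = G"

definition vertex_transitive :: "('a, 'b) pre_digraph \<Rightarrow> bool" where
  "vertex_transitive G \<longleftrightarrow>
    (\<forall>u \<in> verts G. \<forall>v \<in> verts G. \<exists>f. digraph_automorphism G f \<and> iso_verts f u = v)"

text \<open>
  In a loop-free digraph every cycle in the sense of the library has length at least 2
  (\<open>loopfree_digraph.cycle_digraph_conv\<close>).  On natural numbers \<open>Sup\<close> is the maximum of a
  finite nonempty set, and \<open>Sup {} = 0\<close>, so the length is 0 for an acyclic digraph.
\<close>

definition longest_cycle_length :: "('a, 'b) pre_digraph \<Rightarrow> nat" where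
  "longest_cycle_length G = Sup {length p | p. pre_digraph.cycle G p}"

definition perimeter_gap :: "('a, 'b) pre_digraph \<Rightarrow> int" where
  "perimeter_gap G = int (card (verts G)) - int (longest_cycle_length G)"

lemma (in fin_digraph) cycle_length_le_card_verts:
  assumes "cycle p"
  shows "length p \<le> card (verts G)"
proof -
  from assms obtain u where u: "awalk u p u" "distinct (tl (awalk_verts u p))"
    by (auto simp: cycle_def)
  have "set (tl (awalk_verts u p)) \<subseteq> verts G"
    using u(1) by (cases "awalk_verts u p") (simp_all add: awalk_conv)
  then have "card (set (tl (awalk_verts u p))) \<le> card (verts G)"
    by (simp add: card_mono)
  moreover have "card (set (tl (awalk_verts u p))) = length p"
    using u(2) by (simp add: distinct_card length_awalk_verts)
  ultimately show ?thesis by simp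
qed

lemma (in fin_digraph) finite_cycle_lengths: "finite {length p | p. cycle p}"
  by (rule finite_subset[of _ "{..card (verts G)}"]) (auto dest: cycle_length_le_card_verts)

lemma (in fin_digraph) longest_cycle_length_eq_Max:
  assumes "cycle p"
  shows "longest_cycle_length G = Max {length p | p. cycle p}"
  using assms by (auto simp: longest_cycle_length_def Sup_nat_def)

end

(*
  Let G be the circulant digraph on Z_n, n = m d, with connection set {a, a + d} and gcd(a, d) = 1.
  Each arc changes the residue mod d by a, so cycle lengths are multiples of d. On a Hamiltonian
  cycle, v and v + d must use the same generator (otherwise two arcs enter v + a + d), hence the
  choice of generator depends only on v mod d, and d consecutive steps amount to adding d (a + c)
  for a fixed c <= d. If a, a + 1, ..., a + d are all non-coprime to m, this returns to the
  start too early; so there is no Hamiltonian cycle and the perimeter gap is at least d.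
  By the Chinese remainder theorem such a window of length about 2 q exists with m the product of
  the primes up to q and one further prime r. The primorial is at most 4^q, and counting squarefree
  parts gives r <= 4^(q/3 + 3) + 1; as (4/3) ln 4 < 2, already ln n <= d, so epsilon = 0 works.
*)
theory Submission
  imports
    Defs
    "HOL-Analysis.Harmonic_Numbers"
    "HOL-Computational_Algebra.Squarefree"
    "HOL-Number_Theory.Number_Theory"
    "HOL-Real_Asymp.Real_Asymp"
begin

section \<open>Elementary bounds on primes\<close>

lemma prod_primes_dvd:
  fixes N :: nat
  assumes "finite A" "\<And>p. p \<in> A \<Longrightarrow> prime p \<and> p dvd N"
  shows "\<Prod>A dvd N"
  using assms
proof (induction A rule: finite_induct)
  case (insert p A)
  have "coprime p (\<Prod>A)"
    using insert by (intro prod_coprime_right) (metis insert_iff primes_coprime)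
  then show ?case
    using insert by (simp add: divides_mult)
qed simp

text \<open>Erdos's induction: an even n > 2 adds no prime, and for n = 2k + 1 the primes in (k + 1,
  n] contribute at most 4^k, since their product divides a binomial coefficient.\<close>

lemma prod_primes_le_4_power: "\<Prod>{p::nat. prime p \<and> p \<le> n} \<le> 4 ^ n"
proof (induction n rule: less_induct)
  case (less n)
  consider "n \<le> 1" | "n = 2" | "n > 2" "even n" | "n > 2" "odd n" by linarith
  then show ?case
  proof cases
    case 1
    then have "{p::nat. prime p \<and> p \<le> n} = {}" by (auto dest: prime_ge_2_nat)
    then show ?thesis by (simp only:) simp
  next
    case 2
    then have "{p::nat. prime p \<and> p \<le> n} = {2}" by (auto intro: le_antisym dest: prime_ge_2_nat)
    with 2 show ?thesis by simp
  next
    case 3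
    have "\<not> prime n" using 3 prime_odd_nat by auto
    then have "p \<le> n \<longleftrightarrow> p \<le> n - 1" if "prime p" for p
      using that by (cases "p = n") auto
    then have "{p::nat. prime p \<and> p \<le> n} = {p. prime p \<and> p \<le> n - 1}" by blast
    then have "\<Prod>{p::nat. prime p \<and> p \<le> n} \<le> 4 ^ (n - 1)" using less[of "n - 1"] 3 by simp
    also have "\<dots> \<le> 4 ^ n" by (simp add: power_increasing)
    finally show ?thesis .
  next
    case 4
    then obtain k where n: "n = 2 * k + 1" by (elim oddE)
    with 4 have k: "k \<ge> 1" by simp
    let ?B = "{p::nat. prime p \<and> k + 1 < p \<and> p \<le> n}"
    have fin: "finite {p::nat. prime p \<and> p \<le> m}" for m
      by (rule finite_subset[of _ "{..m}"]) auto
    have finB: "finite ?B" by (rule finite_subset[OF _ fin[of n]]) auto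
    \<comment> \<open>p divides n! but, being larger than k + 1, neither k! nor (k + 1)!.\<close>
    have "p dvd (n choose k)" if p: "prime p" "k + 1 < p" "p \<le> n" for p
    proof -
      have "fact k * fact (n - k) * (n choose k) = (fact n :: nat)"
        by (rule binomial_fact_lemma) (simp add: n)
      then have "p dvd fact k * fact (n - k) * (n choose k)"
        using p by (simp add: prime_dvd_fact_iff)
      moreover have "n - k = k + 1" by (simp add: n)
      ultimately show ?thesis
        using p by (simp only: prime_dvd_mult_iff) (simp add: prime_dvd_fact_iff del: fact_Suc)
    qed
    then have "\<Prod>?B dvd (n choose k)" by (intro prod_primes_dvd finB) auto
    then have "\<Prod>?B \<le> (n choose k)" by (rule dvd_imp_le) (simp add: n)
    \<comment> \<open>By symmetry the lower half of row 2k + 1 of Pascal's triangle sums to half of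
      2^(2k + 1).\<close>
    also have "\<dots> \<le> (\<Sum>i\<le>k. n choose i)" by (intro member_le_sum) auto
    also have "\<dots> = 4 ^ k" unfolding n binomial_r_part_sum by (simp add: power_mult)
    finally have B: "\<Prod>?B \<le> 4 ^ k" .
    have "{p::nat. prime p \<and> p \<le> n} = {p. prime p \<and> p \<le> k + 1} \<union> ?B" by (auto simp: n)
    then have "\<Prod>{p::nat. prime p \<and> p \<le> n} = \<Prod>{p. prime p \<and> p \<le> k + 1} * \<Prod>?B"
      using fin finB by (simp only:) (rule prod.union_disjoint, auto)
    also have "\<dots> \<le> 4 ^ (k + 1) * 4 ^ k"
      using B less[of "k + 1"] k by (intro mult_mono) (auto simp: n)
    also have "\<dots> = 4 ^ n" by (simp add: n power_add mult_2)
    finally show ?thesis .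
  qed
qed

text \<open>Apart from 2 and 3, each block 3t, 3t + 1, 3t + 2 holds at most one prime: 3t is
  excluded and one of the other two is even. There are n div 3 + 1 blocks up to n.\<close>

lemma card_primes_le: "card {p::nat. prime p \<and> p \<le> n} \<le> n div 3 + 3"
proof -
  let ?A = "{p::nat. prime p \<and> p \<le> n}"
  have fin: "finite ?A" by (rule finite_subset[of _ "{..n}"]) auto
  have not_dvd: "\<not> 2 dvd p" "\<not> 3 dvd p" if "p \<in> ?A - {2, 3}" for p
    using that primes_dvd_imp_eq[of 2 p] primes_dvd_imp_eq[of 3 p] by auto
  have "inj_on (\<lambda>p. p div 3) (?A - {2, 3})"
  proof (rule inj_onI)
    fix p r assume p: "p \<in> ?A - {2, 3}" and r: "r \<in> ?A - {2, 3}" and eq: "p div 3 = r div 3"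
    have "p mod 3 = 1 \<or> p mod 3 = 2" "r mod 3 = 1 \<or> r mod 3 = 2"
      using not_dvd(2)[OF p] not_dvd(2)[OF r] by (auto simp: dvd_eq_mod_eq_0)
    moreover have "p = 3 * (p div 3) + p mod 3" "r = 3 * (p div 3) + r mod 3"
      by (simp, unfold eq, simp)
    ultimately have "p = r \<or> p = Suc r \<or> r = Suc p" by linarith
    with not_dvd(1)[OF p] not_dvd(1)[OF r] show "p = r" by auto
  qed
  then have "card (?A - {2, 3}) = card ((\<lambda>p. p div 3) ` (?A - {2, 3}))"
    by (simp add: card_image)
  also have "\<dots> \<le> card {..n div 3}" by (intro card_mono) (auto intro: div_le_mono)
  finally have "card (?A - {2, 3}) \<le> n div 3 + 1" by simp
  moreover have "card ?A - card {2, 3 :: nat} \<le> card (?A - {2, 3})"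
    by (rule diff_card_le_card_Diff) simp
  ultimately show ?thesis by simp
qed

text \<open>
  If there were no such prime, then every number up to the bound would be determined by its square
  part and a subset of the primes up to \<open>n\<close>, namely those dividing it to an odd power.
\<close>

lemma ex_prime_gt_bounded:
  fixes n :: nat
  shows "\<exists>p. prime p \<and> n < p \<and> p \<le> 4 ^ card {p::nat. prime p \<and> p \<le> n} + 1"
proof (rule ccontr)
  let ?S = "{p::nat. prime p \<and> p \<le> n}"
  define k where "k = card ?S"
  assume no: "\<not> ?thesis"
  have fin: "finite ?S" by (rule finite_subset[of _ "{..n}"]) auto
  define f :: "nat \<Rightarrow> nat \<times> nat set"
    where "f r = (square_part r, {p. prime p \<and> odd (multiplicity p r)})" for r
  have "inj_on f {1..4 ^ k + 1}"
  proof (rule inj_onI)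
    fix r s assume rs: "r \<in> {1..4 ^ k + 1}" "s \<in> {1..4 ^ k + 1}" and eq: "f r = f s"
    show "r = s"
    proof (rule multiplicity_eq_nat)
      fix p :: nat assume p: "prime p"
      have "multiplicity p r div 2 = multiplicity p s div 2"
        using eq p by (simp add: f_def flip: prime_multiplicity_square_part)
      moreover have "p \<in> snd (f r) \<longleftrightarrow> p \<in> snd (f s)" using eq by simp
      then have "odd (multiplicity p r) \<longleftrightarrow> odd (multiplicity p s)"
        using p by (simp add: f_def)
      ultimately show "multiplicity p r = multiplicity p s" by presburger
    qed (use rs in auto)
  qed
  \<comment> \<open>Pigeonhole: there are 4^k + 1 numbers, but a square part of at most 2^k and 2^k
    sets of primes leave only 4^k pairs.\<close>
  moreover have "f ` {1..4 ^ k + 1} \<subseteq> {1..2 ^ k} \<times> Pow ?S"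
  proof (intro image_subsetI)
    fix r :: nat assume r: "r \<in> {1..4 ^ k + 1}"
    have "square_part r < 2 ^ k + 1"
    proof (rule power_less_imp_less_base[of _ 2])
      have "square_part r ^ 2 \<le> r" using r by (intro dvd_imp_le) auto
      also have "\<dots> \<le> 2 ^ k * 2 ^ k + 1" using r by (simp flip: power_mult_distrib)
      also have "\<dots> < (2 ^ k + 1) ^ 2" by (simp add: power2_eq_square)
      finally show "square_part r ^ 2 < (2 ^ k + 1) ^ 2" .
    qed simp
    moreover have "square_part r \<noteq> 0" using r by simp
    ultimately have "square_part r \<in> {1..2 ^ k}"
      by (simp only: atLeastAtMost_iff) linarith
    moreover have "p \<le> n" if p: "prime p" "odd (multiplicity p r)" for p
    proof -
      have "p dvd r" using p(2) by (metis not_dvd_imp_multiplicity_0 even_zero)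
      then have "p \<le> 4 ^ k + 1" using r dvd_imp_le[of p r] by simp
      with p(1) no show ?thesis unfolding k_def by (meson not_le_imp_less)
    qed
    ultimately show "f r \<in> {1..2 ^ k} \<times> Pow ?S"
      by (auto simp: f_def)
  qed
  ultimately have "card {1..4 ^ k + 1 :: nat} \<le> card ({1..2 ^ k :: nat} \<times> Pow ?S)"
    using fin by (intro card_inj_on_le) auto
  also have "\<dots> = 2 ^ k * 2 ^ k"
    using fin by (simp add: card_cartesian_product card_Pow k_def)
  also have "\<dots> = 4 ^ k" by (simp flip: power_mult_distrib)
  finally show False by simp
qed

section \<open>Excluding a Hamiltonian cycle\<close>

text \<open>\<open>w\<close> lists the vertices of a supposed Hamiltonian cycle. The contradiction
  is a return to the start after \<open>k * d < n\<close> steps, where \<open>k\<close> is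
  \<open>m\<close> divided by its gcd with some \<open>a + c\<close>.\<close>

lemma no_hamiltonian_circulant_walk:
  fixes w :: "nat \<Rightarrow> nat"
  assumes n: "n = m * d" "0 < m" "0 < d"
    and closed: "w n = w 0" and inj: "inj_on w {..<n}" and bound: "\<And>i. i < n \<Longrightarrow> w i < n"
    and step: "\<And>i. i < n \<Longrightarrow> w (Suc i) = (w i + a) mod n \<or> w (Suc i) = (w i + (a + d)) mod n"
    and not_coprime: "\<And>c. c \<le> d \<Longrightarrow> \<not> coprime (a + c) m"
  shows False
proof -
  have "m \<noteq> 1" using not_coprime[of 0] by auto
  with n have "m > 1" "d < n" "n > 0" by auto
  have "w ` {..<n} = {..<n}"
    using bound by (intro endo_inj_surj inj) auto
  then have surj: "\<exists>i<n. w i = v" if "v < n" for v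
    using that by (metis imageE lessThan_iff)
  \<comment> \<open>No two arcs enter the same vertex: since the walk closes up, w 1, ..., w n is a
    cyclic shift of the distinct values w 0, ..., w (n - 1).\<close>
  have suc_inj: "i = j" if "i < n" "j < n" "w (Suc i) = w (Suc j)" for i j
  proof -
    have w_Suc_mod: "w (Suc i mod n) = w (Suc i)" if "i < n" for i
      using that closed by (cases "Suc i = n") auto
    have "w (Suc i mod n) = w (Suc j mod n)"
      using that by (simp only: w_Suc_mod)
    then have "Suc i mod n = Suc j mod n"
      by (rule inj_onD[OF inj]) (simp_all add: \<open>n > 0\<close>)
    then show ?thesis using that by (cases "Suc i = n"; cases "Suc j = n") auto
  qed
  \<comment> \<open>\<open>B\<close> marks the vertices that the cycle leaves by the longer
    generator.\<close>
  define B where "B v \<longleftrightarrow> (\<exists>i<n. w i = v \<and> w (Suc i) = (v + (a + d)) mod n)" for v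
  have B_w: "B (w i) \<longleftrightarrow> w (Suc i) = (w i + (a + d)) mod n" if "i < n" for i
    using that inj unfolding B_def by (auto dest: inj_onD)
  have B_step: "B ((v + d) mod n)" if "v < n" "B v" for v
  proof -
    obtain i where i: "i < n" "w i = v" "w (Suc i) = (v + (a + d)) mod n"
      using \<open>B v\<close> B_def by blast
    obtain j where j: "j < n" "w j = (v + d) mod n" using surj[of "(v + d) mod n"] \<open>n > 0\<close> by auto
    \<comment> \<open>Otherwise the arcs leaving v and v + d would both end in v + a + d, although 0
      < d < n keeps v and v + d distinct mod n.\<close>
    have "w (Suc j) \<noteq> (w j + a) mod n"
    proof
      assume "w (Suc j) = (w j + a) mod n"
      also have "\<dots> = w (Suc i)" unfolding i j by (simp add: mod_simps ac_simps)
      finally have "i = j" using suc_inj i j by metis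
      with i j have "(v + d) mod n = v mod n" using \<open>v < n\<close> by simp
      then have "n dvd (v + d) - v" by (subst (asm) mod_eq_dvd_iff_nat) auto
      with \<open>d < n\<close> n(3) dvd_imp_le[of n d] show False by simp
    qed
    with step[OF j(1)] j show ?thesis unfolding B_def by auto
  qed
  have B_iter: "B ((v + k * d) mod n)" if "v < n" "B v" for v k
  proof (induction k)
    case (Suc k)
    have "B (((v + k * d) mod n + d) mod n)" using \<open>n > 0\<close> by (intro B_step Suc) simp
    then show ?case by (simp add: mod_simps ac_simps)
  qed (use that in simp)
  \<comment> \<open>As d divides n, repeatedly adding d runs through a whole residue class mod d, so
    the one-way implication \<open>B_step\<close> reaches every member. Adding n to v' keeps the
    subtraction from truncating.\<close>
  have B_cong: "B v \<Longrightarrow> B v'" if v: "v < n" "v' < n" "v mod d = v' mod d" for v v'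
  proof -
    have "d dvd (v' + n) - v"
      using v n by (subst mod_eq_dvd_iff_nat[symmetric]) auto
    then obtain k where "(v' + n) - v = d * k" by blast
    then have "v + k * d = v' + n" using v by (simp add: mult.commute)
    then have "(v + k * d) mod n = v'" using v by simp
    then show "B v \<Longrightarrow> B v'" using B_iter[of v k] v by simp
  qed
  define \<delta> :: "nat \<Rightarrow> nat" where "\<delta> i = (if B (w i) then 1 else 0)" for i
  have w_Suc: "w (Suc i) = (w i + a + d * \<delta> i) mod n" if "i < n" for i
    using step[OF that] B_w[OF that] by (auto simp: \<delta>_def ac_simps)
  have w_eq: "w j = (w 0 + j * a + d * (\<Sum>i<j. \<delta> i)) mod n" if "j \<le> n" for j
    using that
  proof (induction j)
    case (Suc j)
    then have "w (Suc j) = (w j + (a + d * \<delta> j)) mod n"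
      by (simp add: w_Suc add.assoc)
    also have "\<dots> = (w 0 + j * a + d * (\<Sum>i<j. \<delta> i) + (a + d * \<delta> j)) mod n"
      using Suc by (simp add: mod_add_left_eq)
    finally show ?case by (simp add: algebra_simps)
  qed (use bound \<open>n > 0\<close> in simp)
  have w_mod: "w j mod d = (w 0 + j * a) mod d" if "j \<le> n" for j
    by (subst w_eq[OF that]) (simp add: n mod_mod_cancel)
  \<comment> \<open>By \<open>w_mod\<close> the residue of \<open>w i\<close> mod d depends only on
    i mod d, and \<open>B\<close> depends only on that residue.\<close>
  have \<delta>_mod: "\<delta> i = \<delta> (i mod d)" if "i < n" for i
  proof -
    have i: "i mod d < n" using \<open>d < n\<close> n by (meson less_trans mod_less_divisor)
    have "(w 0 + i * a) mod d = (w 0 + i mod d * a) mod d"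
      by (metis mod_add_right_eq mod_mult_left_eq)
    then have "w i mod d = w (i mod d) mod d"
      using that i by (simp add: w_mod)
    then have "B (w i) \<longleftrightarrow> B (w (i mod d))"
      using B_cong bound that i by metis
    then show ?thesis by (simp add: \<delta>_def)
  qed
  \<comment> \<open>The number of longer steps among the first d, hence at most d, which brings the
    non-coprimality hypothesis into play.\<close>
  define c where "c = (\<Sum>i<d. \<delta> i)"
  have "c \<le> of_nat (card {..<d}) * 1"
    unfolding c_def by (rule sum_bounded_above) (simp add: \<delta>_def)
  then have "\<not> coprime (a + c) m" by (intro not_coprime) simp
  define g where "g = gcd (a + c) m"
  have "g \<noteq> 1" "g \<noteq> 0" using \<open>\<not> coprime (a + c) m\<close> \<open>0 < m\<close>
    unfolding g_def coprime_iff_gcd_eq_1 by simp_all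
  then have "g > 1" by simp
  have "g dvd m" "g dvd a + c" unfolding g_def by simp_all
  then obtain k x where k: "m = g * k" and x: "a + c = g * x" by (elim dvdE)
  have "0 < k" "k < m" using k n \<open>g > 1\<close> by auto
  then have kd: "k * d < n" using n by simp
  \<comment> \<open>The first k * d steps split into k periods, each with sum c. The total
    displacement d * k * (a + c) is n * x, a multiple of n.\<close>
  have "(\<Sum>i<k * d. \<delta> i) = (\<Sum>i<k * d. \<delta> (i mod d))"
    using kd by (intro sum.cong \<delta>_mod) auto
  also have "\<dots> = (\<Sum>j<k. \<Sum>i = j * d..<j * d + d. \<delta> (i mod d))"
    by (rule sum.nat_group[symmetric])
  also have "\<dots> = (\<Sum>j<k. c)"
  proof (rule sum.cong)
    fix j
    have "(\<Sum>i = 0 + j * d..<d + j * d. \<delta> (i mod d)) = (\<Sum>i = 0..<d. \<delta> ((i + j * d) mod d))"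
      by (rule sum.shift_bounds_nat_ivl)
    also have "\<dots> = c" unfolding c_def by (intro sum.cong) auto
    finally show "(\<Sum>i = j * d..<j * d + d. \<delta> (i mod d)) = c" by (simp add: add.commute)
  qed simp
  finally have "w (k * d) = (w 0 + k * d * a + d * (k * c)) mod n"
    using w_eq[of "k * d"] kd by simp
  also have "w 0 + k * d * a + d * (k * c) = w 0 + d * k * (a + c)"
    by (simp add: algebra_simps)
  also have "\<dots> = w 0 + n * x" unfolding n(1) k x by simp
  also have "\<dots> mod n = w 0" using bound \<open>n > 0\<close> by simp
  finally have "k * d = 0" by (rule inj_onD[OF inj]) (simp_all add: \<open>n > 0\<close> kd)
  with \<open>0 < k\<close> n show False by simp
qed

section \<open>Circulant digraphs\<close>

text \<open>The Cayley digraph of Z_n with connection set S. Arcs are the pairs of endpoints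
  themselves, so elements of S congruent mod n yield one arc, not parallel ones.\<close>

definition circulant_digraph :: "nat \<Rightarrow> nat set \<Rightarrow> (nat, nat \<times> nat) pre_digraph" where
  "circulant_digraph n S =
    \<lparr>verts = {..<n}, arcs = {(u, v). u < n \<and> (\<exists>s\<in>S. v = (u + s) mod n)}, tail = fst, head = snd\<rparr>"

lemma circulant_digraph_simps [simp]:
  "verts (circulant_digraph n S) = {..<n}"
  "arcs (circulant_digraph n S) = {(u, v). u < n \<and> (\<exists>s\<in>S. v = (u + s) mod n)}"
  "tail (circulant_digraph n S) = fst"
  "head (circulant_digraph n S) = snd"
  by (simp_all add: circulant_digraph_def)

lemma wf_digraph_circulant: "wf_digraph (circulant_digraph n S)"
  by unfold_locales auto

lemma finite_arcs_circulant: "finite (arcs (circulant_digraph n S))"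
  by (rule finite_subset[of _ "{..<n} \<times> {..<n}"]) auto

lemma digraph_circulant:
  assumes "\<And>s. s \<in> S \<Longrightarrow> \<not> n dvd s"
  shows "digraph (circulant_digraph n S)"
proof -
  have "u \<noteq> (u + s) mod n" if "u < n" "s \<in> S" for u s
  proof
    assume "u = (u + s) mod n"
    then have "(u + s) mod n = u mod n" using that by simp
    then have "n dvd (u + s) - u" by (subst (asm) mod_eq_dvd_iff_nat) auto
    with assms that show False by simp
  qed
  then show ?thesis
    using finite_arcs_circulant[of n S]
    by unfold_locales (auto simp: arc_to_ends_def)
qed

text \<open>Rotation by v - u is an automorphism taking u to v.\<close>

lemma vertex_transitive_circulant: "vertex_transitive (circulant_digraph n S)"
  unfolding vertex_transitive_def
proof (intro ballI)
  let ?G = "circulant_digraph n S"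
  fix u v assume "u \<in> verts ?G" "v \<in> verts ?G"
  then have uv: "u < n" "v < n" by auto
  \<comment> \<open>The summand n lets a natural number represent v - u mod n.\<close>
  define r where "r = v + n - u"
  define t where "t x = (x + r) mod n" for x
  define f where "f = \<lparr>iso_verts = t, iso_arcs = map_prod t t, iso_head = snd, iso_tail = fst\<rparr>"
  have t_inj: "inj_on t {..<n}"
  proof (rule inj_onI)
    fix x y assume "x \<in> {..<n}" "y \<in> {..<n}" "t x = t y"
    then have "[x + r = y + r] (mod n)" "x < n" "y < n"
      by (simp_all add: t_def Cong.cong_def)
    then show "x = y" by (simp only: cong_add_rcancel_nat) (simp add: Cong.cong_def)
  qed
  have "t ` {..<n} = {..<n}"
    by (intro endo_inj_surj t_inj) (use uv in \<open>auto simp: t_def\<close>)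
  moreover have arcs_inj: "inj_on (map_prod t t) (arcs ?G)"
    using t_inj by (auto simp: inj_on_def)
  \<comment> \<open>An injective self-map of a finite set is onto, so it is enough that arcs go to
    arcs.\<close>
  have "map_prod t t ` arcs ?G = arcs ?G"
  proof (intro endo_inj_surj arcs_inj finite_arcs_circulant image_subsetI)
    fix e assume "e \<in> arcs ?G"
    then obtain x s where "e = (x, (x + s) mod n)" "x < n" "s \<in> S" by auto
    then show "map_prod t t e \<in> arcs ?G"
      using uv by (auto simp: t_def mod_simps ac_simps intro!: bexI[of _ s])
  qed
  moreover have "pre_digraph.digraph_isomorphism ?G f"
    using t_inj arcs_inj wf_digraph_circulant[of n S]
    by (simp add: pre_digraph.digraph_isomorphism_def f_def del: circulant_digraph_simps(2))
  ultimately have "digraph_automorphism ?G f"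
    by (simp add: digraph_automorphism_def app_iso_def f_def circulant_digraph_def)
  moreover have "iso_verts f u = v" using uv by (simp add: f_def t_def r_def)
  ultimately show "\<exists>f. digraph_automorphism ?G f \<and> iso_verts f u = v" by blast
qed

lemma circulant_reachable:
  assumes "u < n" "s \<in> S"
  shows "u \<rightarrow>\<^sup>*\<^bsub>circulant_digraph n S\<^esub> ((u + k * s) mod n)"
proof (induction k)
  case 0
  then show ?case using assms by (simp add: reachable_def)
next
  case (Suc k)
  interpret wf_digraph "circulant_digraph n S" by (rule wf_digraph_circulant)
  have "((u + k * s) mod n, (u + Suc k * s) mod n) \<in> arcs (circulant_digraph n S)"
    using assms by (auto simp: mod_simps ac_simps intro!: bexI[of _ s])
  from in_arcs_imp_in_arcs_ends[OF this]
  have "((u + k * s) mod n) \<rightarrow>\<^bsub>circulant_digraph n S\<^esub> ((u + Suc k * s) mod n)" by simp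
  with Suc show ?case by (rule reachable_adj_trans)
qed

text \<open>With p a + q d = 1, a displacement t equals (p - q) t steps of a and q t steps of a + d.
  Reducing these coefficients mod n makes them natural numbers, so there is even a directed
  path.\<close>

lemma connected_circulant:
  assumes "n > 0" "coprime a d"
  shows "Digraph_Component.connected (circulant_digraph n {a, a + d})"
  unfolding Digraph_Component.connected_def
proof (rule strongly_connectedI)
  let ?G = "circulant_digraph n {a, a + d}"
  interpret wf_digraph ?G by (rule wf_digraph_circulant)
  show "verts (with_proj (mk_symmetric ?G)) \<noteq> {}" using assms by auto
  fix u v assume "u \<in> verts (with_proj (mk_symmetric ?G))" "v \<in> verts (with_proj (mk_symmetric ?G))"
  then have uv: "u < n" "v < n" by auto
  obtain p q :: int where pq: "p * int a + q * int d = 1"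
    using bezout_int[of "int a" "int d"] assms by auto
  define t y x where "t = int v - int u" and "y = nat ((q * t) mod int n)"
    and "x = nat ((p * t - q * t) mod int n)"
  have "[int (u + x * a + y * (a + d))
      = int u + (p * t - q * t) * int a + (q * t) * (int a + int d)] (mod int n)"
    using assms unfolding of_nat_add of_nat_mult
    by (intro cong_add cong_mult cong_refl) (simp_all add: x_def y_def Cong.cong_def)
  also have "int u + (p * t - q * t) * int a + (q * t) * (int a + int d)
      = int u + t * (p * int a + q * int d)" by (simp add: algebra_simps)
  also have "\<dots> = int v" by (simp add: pq t_def)
  finally have "[u + x * a + y * (a + d) = v] (mod n)" by (simp only: cong_int_iff)
  then have v: "v = ((u + x * a) mod n + y * (a + d)) mod n"
    using uv by (simp add: Cong.cong_def mod_simps)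
  have "u \<rightarrow>\<^sup>*\<^bsub>?G\<^esub> ((u + x * a) mod n)" using uv by (intro circulant_reachable) auto
  also have "\<dots> \<rightarrow>\<^sup>*\<^bsub>?G\<^esub> v" unfolding v using uv by (intro circulant_reachable) auto
  finally show "u \<rightarrow>\<^sup>*\<^bsub>with_proj (mk_symmetric ?G)\<^esub> v" by (rule reachable_mk_symmetricI)
qed

section \<open>Cycle lengths and the perimeter gap\<close>

text \<open>Turns a cycle given as a list of arcs into a closed sequence of residues,
  \<open>w i\<close> being the tail of the i-th arc.\<close>

lemma circulant_cycleE:
  assumes "pre_digraph.cycle (circulant_digraph n S) p"
  obtains w where "w (length p) = w 0" "inj_on w {..<length p}"
    "\<And>i. i < length p \<Longrightarrow> w i < n"
    "\<And>i. i < length p \<Longrightarrow> \<exists>s\<in>S. w (Suc i) = (w i + s) mod n"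
proof -
  let ?G = "circulant_digraph n S"
  interpret wf_digraph ?G by (rule wf_digraph_circulant)
  obtain u where u: "awalk u p u" "distinct (tl (awalk_verts u p))" "p \<noteq> []"
    using assms by (auto simp: cycle_def)
  then have cas: "cas u p u" and arcs: "set p \<subseteq> arcs ?G" unfolding awalk_def by auto
  define w where "w i = awalk_verts u p ! i" for i
  have tail: "w i = fst (p ! i)" and head: "w (Suc i) = snd (p ! i)" if "i < length p" for i
    using that u(3) unfolding w_def
    by (simp add: awalk_verts_conv nth_append, simp add: awalk_verts_conv'[OF cas])
  have "w 0 = awhd u p" "w (length p) = awlast u p"
    by (simp_all add: w_def hd_conv_nth last_conv_nth length_awalk_verts)
  then have closed: "w (length p) = w 0" using u(1) by simp
  have "distinct (map snd p)" using u(2,3) by (simp add: awalk_verts_conv'[OF cas])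
  then have suc_inj: "i = j" if "i < length p" "j < length p" "w (Suc i) = w (Suc j)" for i j
    using that by (auto simp: head distinct_conv_nth)
  have inj: "inj_on w {..<length p}"
  proof (rule inj_onI)
    fix i j assume ij: "i \<in> {..<length p}" "j \<in> {..<length p}" "w i = w j"
    \<comment> \<open>Distinctness is known for the heads w 1, ..., w (length p). Each
      \<open>w i\<close> is the head of the cyclically preceding arc, which carries it over to the
      tails.\<close>
    have "\<exists>i'<length p. w (Suc i') = w i \<and> i = Suc i' mod length p" if "i < length p" for i
    proof (cases i)
      case 0
      with that closed show ?thesis by (intro exI[of _ "length p - 1"]) auto
    next
      case (Suc i')
      with that show ?thesis by (intro exI[of _ i']) auto
    qed
    then obtain i' j' where "i' < length p" "w (Suc i') = w i" "i = Suc i' mod length p"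
      "j' < length p" "w (Suc j') = w j" "j = Suc j' mod length p" using ij by auto metis
    with ij suc_inj show "i = j" by metis
  qed
  have "p ! i \<in> arcs ?G" if "i < length p" for i using arcs nth_mem[OF that] by blast
  then have "w i < n" "\<exists>s\<in>S. w (Suc i) = (w i + s) mod n" if "i < length p" for i
    using that by (fastforce simp: tail head)+
  with that closed inj show ?thesis by blast
qed

text \<open>Both generators are a mod d and a is invertible mod d, so closing up forces d to divide
  the length. As d also divides n, a length other than n falls short by at least d.\<close>

lemma circulant_cycle_length:
  assumes n: "n = m * d" "0 < m" "0 < d" and "coprime a d"
    and not_coprime: "\<And>c. c \<le> d \<Longrightarrow> \<not> coprime (a + c) m"
    and "pre_digraph.cycle (circulant_digraph n {a, a + d}) p"
  shows "length p \<le> n - d"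
proof -
  obtain w where w: "w (length p) = w 0" "inj_on w {..<length p}"
    "\<And>i. i < length p \<Longrightarrow> w i < n"
    "\<And>i. i < length p \<Longrightarrow> \<exists>s\<in>{a, a + d}. w (Suc i) = (w i + s) mod n"
    using circulant_cycleE[OF assms(6)] by metis
  have "card {..<length p} \<le> card {..<n}"
    using w(2,3) by (intro card_inj_on_le[of w]) auto
  then have le: "length p \<le> n" by simp
  have "length p \<noteq> n"
    using no_hamiltonian_circulant_walk[OF n, of w a] w not_coprime by auto
  have "w j mod d = (w 0 + j * a) mod d" if "j \<le> length p" for j
    using that
  proof (induction j)
    case (Suc j)
    then obtain s where s: "s \<in> {a, a + d}" "w (Suc j) = (w j + s) mod n" using w(4)[of j] by auto
    have "w (Suc j) mod d = (w j + s) mod d" by (simp add: s n mod_mod_cancel)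
    also have "\<dots> = (w j mod d + a) mod d" using s by (auto simp: mod_simps simp flip: add.assoc)
    also have "\<dots> = (w 0 + Suc j * a) mod d" using Suc by (simp add: mod_simps ac_simps)
    finally show ?case .
  qed simp
  from this[of "length p"] have "(w 0 + length p * a) mod d = w 0 mod d" using w(1) by simp
  then have "d dvd (w 0 + length p * a) - w 0" by (subst (asm) mod_eq_dvd_iff_nat) auto
  then have "d dvd length p"
    using \<open>coprime a d\<close> by (simp add: coprime_dvd_mult_left_iff coprime_commute)
  then have "d dvd n - length p" using n by (intro dvd_diff_nat) auto
  with le \<open>length p \<noteq> n\<close> have "d \<le> n - length p" by (intro dvd_imp_le) auto
  with le show ?thesis by simp
qed

lemma perimeter_gap_circulant:
  assumes n: "n = m * d" "0 < m" "0 < d" and "coprime a d"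
    and not_coprime: "\<And>c. c \<le> d \<Longrightarrow> \<not> coprime (a + c) m"
  shows "perimeter_gap (circulant_digraph n {a, a + d}) \<ge> int d"
proof -
  let ?L = "{length p | p. pre_digraph.cycle (circulant_digraph n {a, a + d}) p}"
  have "Sup ?L \<le> n - d"
  proof (cases "?L = {}")
    \<comment> \<open>Without cycles the supremum takes its default value 0.\<close>
    case True
    then show ?thesis by (simp only: Sup_nat_def) simp
  next
    case False
    then show ?thesis
      using circulant_cycle_length[OF assms] by (intro cSup_least) auto
  qed
  moreover have "d \<le> n" using n by simp
  ultimately show ?thesis
    by (simp add: perimeter_gap_def longest_cycle_length_def)
qed

section \<open>A window sieved by few primes\<close>

text \<open>
  Sieving a window of length \<open>2 * (q - 3) + 1\<close>: write it as \<open>N + j\<close> with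
  \<open>-(q - 2) \<le> j \<le> q - 4\<close>, where \<open>N\<close> is divisible by every prime below \<open>q\<close>.
  All \<open>j\<close> except \<open>1\<close> and \<open>-1\<close> share such a prime with \<open>N\<close>; the primes \<open>q\<close> and \<open>r\<close>
  take care of these two.
\<close>

lemma ex_sieved_interval:
  fixes q :: nat
  assumes q: "prime q" "q \<ge> 7"
  shows "\<exists>m a. 0 < m \<and> m \<le> 4 ^ q * (4 ^ (q div 3 + 3) + 1) \<and> coprime a (2 * (q - 3)) \<and>
    (\<forall>c \<le> 2 * (q - 3). \<not> coprime (a + c) m)"
proof -
  obtain r where r: "prime r" "q < r" "r \<le> 4 ^ card {p::nat. prime p \<and> p \<le> q} + 1"
    using ex_prime_gt_bounded by blast
  have "(4::nat) ^ card {p::nat. prime p \<and> p \<le> q} \<le> 4 ^ (q div 3 + 3)"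
    using card_primes_le by (intro power_increasing) auto
  with r(3) have r_le: "r \<le> 4 ^ (q div 3 + 3) + 1" by linarith
  define P where "P = \<Prod>{p::nat. prime p \<and> p \<le> q - 1}"
  have fin: "finite {p::nat. prime p \<and> p \<le> k}" for k
    by (rule finite_subset[of _ "{..k}"]) auto
  have "p \<le> q \<longleftrightarrow> p = q \<or> p \<le> q - 1" for p using q by auto
  then have "{p. prime p \<and> p \<le> q} = insert q {p. prime p \<and> p \<le> q - 1}"
    using q by blast
  moreover have "q \<notin> {p. prime p \<and> p \<le> q - 1}" using q by simp
  ultimately have "\<Prod>{p. prime p \<and> p \<le> q} = q * P"
    unfolding P_def by (simp add: fin)
  with prod_primes_le_4_power[of q] have P_le: "P * q \<le> 4 ^ q" by (simp add: mult.commute)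
  have "P > 0" unfolding P_def by (intro prod_pos) (auto simp: prime_gt_0_nat)
  have dvd_P: "p dvd P" if "prime p" "p < q" for p
    unfolding P_def using that by (intro dvd_prodI fin) auto
  have coprime_P: "coprime P s" if "prime s" "q \<le> s" for s
    unfolding P_def using that q by (intro prod_coprime_left primes_coprime) auto
  have "coprime (P * q) r"
    using coprime_P[of r] q r by (simp add: primes_coprime)
  define m where "m = P * q * r"
  have "m > 0" using \<open>P > 0\<close> q r by (simp add: m_def)
  have "m \<le> 4 ^ q * (4 ^ (q div 3 + 3) + 1)"
    unfolding m_def using P_le r_le by (rule mult_le_mono)
  \<comment> \<open>N is to be 0 mod P, 1 mod q and -1 mod r, the last written as r - 1. Then q
    divides N - 1 and r divides N + 1.\<close>
  obtain y where y: "[y = 0] (mod P)" "[y = 1] (mod q)"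
    using binary_chinese_remainder_nat[OF coprime_P[OF q(1) order_refl]] by blast
  obtain z where z: "[z = y] (mod P * q)" "[z = r - 1] (mod r)"
    using binary_chinese_remainder_nat[OF \<open>coprime (P * q) r\<close>] by blast
  \<comment> \<open>Adding m keeps all residues and ensures N >= q, so that
    \<open>N - (q - 2)\<close> does not truncate.\<close>
  define N where "N = z + m"
  have "q dvd m" by (simp add: m_def)
  then have "q \<le> m" using \<open>m > 0\<close> by (rule dvd_imp_le)
  then have "N \<ge> q" by (simp add: N_def)
  have "[m = 0] (mod P * q)" "[m = 0] (mod r)" by (simp_all add: m_def cong_0_iff)
  then have N_y: "[N = y] (mod P * q)" and N_r: "[N = r - 1] (mod r)"
    using cong_add[OF z(1)] cong_add[OF z(2)] unfolding N_def by force+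
  have "[N = y] (mod P)" "[N = y] (mod q)"
    using N_y cong_modulus_mult_nat[of N y P q] cong_modulus_mult_nat[of N y q P]
    by (simp_all add: mult.commute)
  then have "[N = 0] (mod P)" "[N = 1] (mod q)"
    using y by (blast intro: cong_trans)+
  then have P_dvd: "P dvd N" and q_dvd: "q dvd N - 1"
    using \<open>N \<ge> q\<close> q by (auto simp: cong_0_iff cong_altdef_nat)
  have "[N + 1 = (r - 1) + 1] (mod r)"
    using N_r by (intro cong_add cong_refl)
  moreover have "(r - 1) + 1 = r" using r by simp
  ultimately have r_dvd: "r dvd N + 1" using cong_dvd_iff by (metis dvd_refl)
  have small_dvd: "p dvd N" if "prime p" "p < q" for p
    using dvd_trans[OF dvd_P[OF that] P_dvd] .
  have "odd q" using q prime_odd_nat by auto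
  define a where "a = N - (q - 2)"
  have N: "N = a + (q - 2)" using \<open>N \<ge> q\<close> by (simp add: a_def)
  \<comment> \<open>A common prime is below q, so it divides N and hence q - 2. It then divides 2 (q
    - 2) - 2 (q - 3) = 2, but q - 2 is odd.\<close>
  have "coprime a (2 * (q - 3))"
  proof (rule ccontr)
    assume "\<not> coprime a (2 * (q - 3))"
    then obtain p where p: "prime p" "p dvd a" "p dvd 2 * (q - 3)"
      unfolding coprime_iff_gcd_eq_1 by (meson gcd_greatest_iff prime_factor_nat)
    then have "p \<le> 2 \<or> p \<le> q - 3"
      using q by (auto simp: prime_dvd_mult_iff dest!: dvd_imp_le)
    then have "p < q" using q by linarith
    then have "p dvd q - 2" using small_dvd[of p] p N by (simp add: dvd_add_right_iff)
    moreover have "2 * (q - 2) = 2 * (q - 3) + 2" using q by simp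
    ultimately have "p dvd 2" using p(3) by (metis dvd_add_right_iff dvd_mult)
    then have "p = 2" using p(1) by (simp add: primes_dvd_imp_eq)
    with \<open>p dvd q - 2\<close> \<open>odd q\<close> q show False by simp
  qed
  moreover have "\<not> coprime (a + c) m" if c: "c \<le> 2 * (q - 3)" for c
  proof -
    have dvd_m: "p dvd m" if "prime p" "p < q" for p
      using dvd_P[OF that] by (simp add: m_def)
    have "\<exists>p. prime p \<and> p dvd a + c \<and> p dvd m"
    proof -
      \<comment> \<open>The offset c - (q - 2) from N is 0, -1, 1, at most -2, or at least 2. In the
        last two cases its absolute value is below q and has a prime factor, which also divides
        N.\<close>
      consider "c = q - 2" | "c = q - 3" | "c = q - 1" | "c < q - 3" | "q - 1 < c" by linarith
      then show ?thesis
      proof cases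
        case 1
        then have "a + c = N" using N by simp
        then show ?thesis using small_dvd[of 2] dvd_m[of 2] q by (intro exI[of _ 2]) simp
      next
        case 2
        then have "a + c = N - 1" using N q by simp
        then show ?thesis using q_dvd q by (auto simp: m_def)
      next
        case 3
        then have "a + c = N + 1" using N q by simp
        then show ?thesis using r_dvd r by (auto simp: m_def)
      next
        case 4
        then have "q - 2 - c \<noteq> 1" by linarith
        then obtain p where p: "prime p" "p dvd q - 2 - c"
          using prime_factor_nat by blast
        from p(2) have "p \<le> q - 2 - c" by (rule dvd_imp_le) (use 4 in simp)
        then have "p < q" using q by linarith
        moreover have "N = (q - 2 - c) + (a + c)" using N 4 by simp
        ultimately show ?thesis
          using p small_dvd[of p] dvd_m by (metis dvd_add_right_iff)
      next
        case 5
        then have "c - (q - 2) \<noteq> 1" using q by linarith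
        then obtain p where p: "prime p" "p dvd c - (q - 2)"
          using prime_factor_nat by blast
        from p(2) have "p \<le> c - (q - 2)" by (rule dvd_imp_le) (use 5 in simp)
        then have "p < q" using q c by linarith
        moreover have "a + c = N + (c - (q - 2))" using N 5 by simp
        ultimately show ?thesis using p small_dvd[of p] dvd_m by (metis dvd_add)
      qed
    qed
    then show ?thesis by (meson coprime_common_divisor not_prime_unit)
  qed
  ultimately show ?thesis
    using \<open>m > 0\<close> \<open>m \<le> 4 ^ q * (4 ^ (q div 3 + 3) + 1)\<close> by blast
qed

section \<open>The logarithmic estimate and the conclusion\<close>

lemma ex_circulant_large_gap:
  "\<exists>n \<ge> K. \<exists>G :: (nat, nat \<times> nat) pre_digraph.
      digraph G \<and> Digraph_Component.connected G \<and> vertex_transitive G \<and>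
      card (verts G) = n \<and> ln (real n) \<le> real_of_int (perimeter_gap G)"
proof -
  \<comment> \<open>At x = q the left side will bound ln (m d) and the right side is d: 4/3 x + 4
    bounds the exponent of 4 in the bound for m, 25/18 bounds ln 4, and 2x bounds d. It holds
    eventually because 4/3 * 25/18 = 50/27 < 2.\<close>
  have "eventually (\<lambda>x::real. (4 / 3 * x + 4) * (25 / 18) + ln (2 * x) \<le> 2 * (x - 3)) at_top"
    by real_asymp
  then obtain X :: real
    where X: "\<And>x. x \<ge> X \<Longrightarrow> (4 / 3 * x + 4) * (25 / 18) + ln (2 * x) \<le> 2 * (x - 3)"
    by (auto simp: eventually_at_top_linorder)
  \<comment> \<open>Taking q > K makes the order large, since n >= d >= q.\<close>
  obtain q :: nat where q: "prime q" "q > max (max K 7) (nat \<lceil>X\<rceil>)"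
    using bigger_prime by blast
  then have "K \<le> q" "7 \<le> q" "X \<le> real q" by linarith+
  define d where "d = 2 * (q - 3)"
  obtain m a where m: "0 < m" "m \<le> 4 ^ q * (4 ^ (q div 3 + 3) + 1)" "coprime a d"
    "\<And>c. c \<le> d \<Longrightarrow> \<not> coprime (a + c) m"
    using ex_sieved_interval[OF q(1) \<open>7 \<le> q\<close>] unfolding d_def by blast
  define n where "n = m * d"
  have d: "q \<le> d" "d < 2 * q" "0 < d" using \<open>7 \<le> q\<close> by (auto simp: d_def)
  have "d \<le> n" using m(1) by (simp add: n_def)
  have "m \<noteq> 1" using m(4)[of 0] by auto
  then have "d < n" using m(1) d by (simp add: n_def)
  \<comment> \<open>The summand 1 is absorbed by one more factor 4.\<close>
  have "(4::nat) ^ q * (4 ^ (q div 3 + 3) + 1) \<le> 4 ^ q * 4 ^ (q div 3 + 4)"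
    using one_le_power[of "4::nat" "q div 3 + 3"] by (intro mult_le_mono) (auto simp: power_add)
  with m(2) have "m \<le> 4 ^ q * 4 ^ (q div 3 + 4)" by (rule order_trans)
  then have "m \<le> 4 ^ (q + (q div 3 + 4))" by (simp only: power_add)
  then have "real m \<le> 4 ^ (q + (q div 3 + 4))" by (metis of_nat_le_iff of_nat_numeral of_nat_power)
  then have "ln (real m) \<le> ln (4 ^ (q + (q div 3 + 4)))" using m(1) by simp
  also have "\<dots> = real (q + (q div 3 + 4)) * (2 * ln 2)"
    using ln_realpow[of "2::real" 2] by (simp add: ln_realpow)
  also have "\<dots> \<le> (4 / 3 * real q + 4) * (25 / 18)"
    using ln2_le_25_over_36 by (intro mult_mono) auto
  finally have "ln (real n) \<le> (4 / 3 * real q + 4) * (25 / 18) + ln (real d)"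
    using m(1) d by (simp add: n_def ln_mult)
  also have "\<dots> \<le> (4 / 3 * real q + 4) * (25 / 18) + ln (2 * real q)"
    using d by simp
  also have "\<dots> \<le> real d" using X[OF \<open>X \<le> real q\<close>] \<open>7 \<le> q\<close> by (simp add: d_def of_nat_diff)
  finally have "ln (real n) \<le> real d" .
  \<comment> \<open>This excludes loops: n is a multiple of d, while neither a nor a + d is.\<close>
  have not_dvd_a: "\<not> d dvd a"
  proof
    assume "d dvd a"
    with m(3) have "d dvd 1" by (meson coprime_common_divisor dvd_refl)
    with d \<open>7 \<le> q\<close> show False by simp
  qed
  let ?G = "circulant_digraph n {a, a + d}"
  have "digraph ?G"
    using not_dvd_a by (intro digraph_circulant) (auto simp: n_def dest: dvd_mult_right)
  moreover have "int d \<le> perimeter_gap ?G"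
    using m d by (intro perimeter_gap_circulant[of n m]) (auto simp: n_def)
  then have "ln (real n) \<le> real_of_int (perimeter_gap ?G)"
    using \<open>ln (real n) \<le> real d\<close> by linarith
  moreover have "Digraph_Component.connected ?G"
    using m(3) \<open>d < n\<close> by (intro connected_circulant) auto
  ultimately show ?thesis
    using vertex_transitive_circulant[of n "{a, a + d}"] \<open>K \<le> q\<close> d \<open>d \<le> n\<close>
    by (intro exI[of _ n] conjI exI[of _ ?G]) auto
qed

theorem theorem1p1:
  shows "\<exists>(N :: nat set) (\<epsilon> :: nat \<Rightarrow> real).
    infinite N \<and> (\<forall>n. 0 \<le> \<epsilon> n) \<and> \<epsilon> \<longlonglongrightarrow> 0 \<and>
    (\<forall>n \<in> N. \<exists>G :: (nat, nat \<times> nat) pre_digraph.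
      digraph G \<and> Digraph_Component.connected G \<and> vertex_transitive G \<and>
      card (verts G) = n \<and>
      real_of_int (perimeter_gap G) \<ge> (1 - \<epsilon> n) * ln (real n))"
proof -
  define N where "N = {n. \<exists>G :: (nat, nat \<times> nat) pre_digraph.
      digraph G \<and> Digraph_Component.connected G \<and> vertex_transitive G \<and>
      card (verts G) = n \<and> ln (real n) \<le> real_of_int (perimeter_gap G)}"
  have "infinite N"
    unfolding infinite_nat_iff_unbounded_le N_def using ex_circulant_large_gap by blast
  then show ?thesis
    by (intro exI[of _ N] exI[of _ "\<lambda>_. 0"]) (auto simp: N_def)
qed

end
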